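(* Let $\mathcal{A}$ be a finite linearly ordered alphabet, and let $w \in \mathcal{A}^n$ be a random word whose letters are generated (either from left to right or from right to left) by a Markov chain with state set $\mathcal{A}$ (not necessarily EPRI). For every integer $\ell \geqslant 0$ there exists an integer $N$ such that, for all $n \geqslant N$, the probability that the IS-algorithm, run on $w$, performs more than \[2 \log_2(\log_2(n)) + \ell\] recursive function calls is at most $n^{-2^{\ell}}$.
   Context: Words are indexed from $0$: $w = w_0 \cdots w_{|w|-1}$, and $w_{i \cdots j} = w_i \cdots w_j$. A sentinel letter $\$ \notin \mathcal{A}$ is smaller than every letter of $\mathcal{A}$, and $w_{|w|} = \$$. An integer $i \leqslant |w|-1$ is $w$-non-decreasing if there is $j$ with $i+1 \leqslant j \leqslant |w|-1$ and $w_i = \cdots = w_{j-1} < w_j$; it is $w$-locally minimal if moreover $i \geqslant 1$ and $w_{i-1} > w_i$. If $i_0 < \cdots < i_{k-1}$ are the $w$-locally minimal integers and $i_k = |w|$, the unimodal factors of $w$ are $w_{i_0 \cdots i_1}, \ldots, w_{i_{k-1} \cdots i_k}$; $\mathsf{eis}(w)$ is the length-$k$ word over the lexicographically ordered alphabet $\mathcal{A}^+\cdot(\varepsilon+\$)$ whose letters are these factors in order; $\mathsf{is}(w)$ is obtained from $\mathsf{eis}(w)$ by replacing each letter by its rank (from $0$) among the distinct letters of $\mathsf{eis}(w)$. The IS-algorithm computes the suffix array of its input word $v$ by computing $\mathsf{is}(v)$ and then computing the suffix array of $\mathsf{is}(v)$, directly if the letters of $\mathsf{is}(v)$ are pairwise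 distinct, and by a recursive call of the IS-algorithm on $\mathsf{is}(v)$ otherwise. A Markov chain with state set $\mathcal{A}$, initial distribution $\mu$ and transition matrix $M$ produces trajectories $(X_n)_{n\geqslant 0}$ with $\mathbb{P}(X_0=x)=\mu(x)$ and $\mathbb{P}(X_n = x_n \mid X_0,\ldots,X_{n-1}) = M(X_{n-1},x_n)$. The letters of $w \in \mathcal{A}^n$ are generated from left to right if $w_k = X_k$ for $0 \leqslant k < n$, and from right to left if $w_{n-1-k} = X_k$. *)

theory Defs
  imports "HOL-Probability.Probability" "HOL-Library.List_Lexorder" "HOL-Library.Option_ord"
begin

definition non_decreasing_at :: "'a::linorder list \<Rightarrow> nat \<Rightarrow> bool" where
  "non_decreasing_at w i \<longleftrightarrow>
     (\<exists>j. i + 1 \<le> j \<and> j < length w \<and> (\<forall>k\<in>{i..<j}. w ! k = w ! i) \<and> w ! (j - 1) < w ! j)"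

definition locally_minimal_at :: "'a::linorder list \<Rightarrow> nat \<Rightarrow> bool" where
  "locally_minimal_at w i \<longleftrightarrow> non_decreasing_at w i \<and> i \<ge> 1 \<and> w ! (i - 1) > w ! i"

text \<open>The sentinel is \<^const>\<open>None\<close>, which lies below every \<^term>\<open>Some x\<close> in the
  order of \<^theory>\<open>HOL-Library.Option_ord\<close>.\<close>

definition with_sentinel :: "'a list \<Rightarrow> 'a option list" where
  "with_sentinel w = map Some w @ [None]"

text \<open>Both end positions are included, and \<^term>\<open>j\<close> may be the sentinel position
  \<^term>\<open>length w\<close>.\<close>

definition factor :: "'a list \<Rightarrow> nat \<Rightarrow> nat \<Rightarrow> 'a option list" where
  "factor w i j = map (\<lambda>k. with_sentinel w ! k) [i..<j + 1]"

definition cut_points :: "'a::linorder list \<Rightarrow> nat list" where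
  "cut_points w = filter (locally_minimal_at w) [0..<length w] @ [length w]"

definition eis :: "'a::linorder list \<Rightarrow> 'a option list list" where
  "eis w = map (\<lambda>m. factor w (cut_points w ! m) (cut_points w ! (m + 1)))
             [0..<length (cut_points w) - 1]"

text \<open>The order \<open><\<close> on factors is the lexicographic one of
  \<^theory>\<open>HOL-Library.List_Lexorder\<close>, in which a proper prefix is smaller.\<close>

definition is_word :: "'a::linorder list \<Rightarrow> nat list" where
  "is_word w = map (\<lambda>u. card {v \<in> set (eis w). v < u}) (eis w)"

lemma length_is_word: "length (is_word w) = length (filter (locally_minimal_at w) [0..<length w])"
  by (simp add: is_word_def eis_def cut_points_def)

lemma length_is_word_less:
  assumes "w \<noteq> []"
  shows "length (is_word w) < length w"
proof -
  have "\<not> locally_minimal_at w 0"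
    by (simp add: locally_minimal_at_def)
  moreover have "0 \<in> set [0..<length w]"
    using assms by simp
  ultimately have "length (filter (locally_minimal_at w) [0..<length w]) < length [0..<length w]"
    by (intro length_filter_less)
  then show ?thesis
    by (simp add: length_is_word)
qed

text \<open>Every recursive call takes place on a word over \<^typ>\<open>nat\<close>, so the recursion is defined
  there; \<open>is_rec_calls\<close> below covers input words over an arbitrary alphabet. The initial call on
  the input word is not itself a recursive call.\<close>

function is_rec_calls_nat :: "nat list \<Rightarrow> nat" where
  "is_rec_calls_nat v =
     (if distinct (is_word v) then 0 else 1 + is_rec_calls_nat (is_word v))"
  by auto
termination
proof (relation "Wellfounded.measure length")
  fix v :: "nat list"
  assume "\<not> distinct (is_word v)"
  then have "v \<noteq> []"
    by (auto simp: is_word_def eis_def cut_points_def)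
  then show "(is_word v, v) \<in> Wellfounded.measure length"
    by (simp add: length_is_word_less)
qed simp

declare is_rec_calls_nat.simps [simp del]

definition is_rec_calls :: "'a::linorder list \<Rightarrow> nat" where
  "is_rec_calls v =
     (if distinct (is_word v) then 0 else 1 + is_rec_calls_nat (is_word v))"

locale finite_markov_chain = prob_space P
  for P :: "'w measure" +
  fixes \<mu> :: "'a::finite \<Rightarrow> real"
    and M :: "'a \<Rightarrow> 'a \<Rightarrow> real"
    and X :: "nat \<Rightarrow> 'w \<Rightarrow> 'a"
  assumes \<mu>_nonneg: "\<And>x. \<mu> x \<ge> 0"
    and \<mu>_sum: "(\<Sum>x\<in>UNIV. \<mu> x) = 1"
    and M_nonneg: "\<And>x y. M x y \<ge> 0"
    and M_sum: "\<And>x. (\<Sum>y\<in>UNIV. M x y) = 1"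
    and X_measurable: "\<And>n. X n \<in> measurable P (count_space UNIV)"
    and X_initial: "\<And>x. \<P>(\<omega> in P. X 0 \<omega> = x) = \<mu> x"
    and X_step: "\<And>n x. \<P>(\<omega> in P. \<forall>k<n+1. X k \<omega> = x k) > 0 \<Longrightarrow>
       \<P>(\<omega> in P. X (n + 1) \<omega> = x (n + 1) \<bar> \<forall>k<n+1. X k \<omega> = x k) = M (x n) (x (n + 1))"

definition left_to_right :: "(nat \<Rightarrow> 'w \<Rightarrow> 'a) \<Rightarrow> nat \<Rightarrow> 'w \<Rightarrow> 'a list" where
  "left_to_right X n \<omega> = map (\<lambda>k. X k \<omega>) [0..<n]"

definition right_to_left :: "(nat \<Rightarrow> 'w \<Rightarrow> 'a) \<Rightarrow> nat \<Rightarrow> 'w \<Rightarrow> 'a list" where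
  "right_to_left X n \<omega> = map (\<lambda>i. X (n - 1 - i) \<omega>) [0..<n]"

end

theory Submission
  imports Defs "HOL-Real_Asymp.Real_Asymp"
begin

text \<open>After \<open>r\<close> recursive calls, each letter stands for a block of at least \<open>2 ^ r\<close> letters of
  the input, and the algorithm goes on only if two disjoint blocks are equal. Call a state forced
  if it has a successor of probability 1. A trajectory consists of a part in which every
  \<open>CARD('a)\<close> consecutive states contain an unforced one, followed by a deterministic cycle of
  length \<open>p \<le> CARD('a)\<close>. On a \<open>p\<close>-periodic stretch of the input the block boundaries are
  \<open>p\<close>-periodic too, up to \<open>O(p r)\<close> letters at both ends; as blocks are longer than \<open>p\<close> once
  \<open>2 ^ r > p\<close>, no boundary is left inside the stretch. Hence one of the two equal blocks lies
  essentially in the first part, so the trajectory reproduces earlier letters at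
  \<open>R\<close> unforced transitions, where \<open>R\<close> is of order \<open>2 ^ r\<close>. For given positions this has
  probability at most \<open>\<rho> ^ R\<close> with \<open>\<rho> < 1\<close>, and there are at most \<open>n\<^sup>2\<close> pairs of positions.
  As \<open>2 ^ r\<close> is about \<open>2 ^ l * (log 2 n)\<^sup>2\<close>, there is room for all constants.\<close>

section \<open>Cut points\<close>

lemma sorted_wrt_cut_points: "sorted_wrt (<) (cut_points v)"
  by (auto simp: cut_points_def sorted_wrt_append intro!: sorted_wrt_filter)

lemma length_cut_points: "length (cut_points v) = Suc (length (is_word v))"
  by (simp add: cut_points_def length_is_word)

lemma cut_points_last: "cut_points v ! length (is_word v) = length v"
  by (simp add: cut_points_def length_is_word nth_append)

lemma cut_points_less_iff:
  "\<lbrakk>i \<le> length (is_word v); j \<le> length (is_word v)\<rbrakk> \<Longrightarrow> cut_points v ! i < cut_points v ! j \<longleftrightarrow> i < j"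
  using sorted_wrt_nth_less[OF sorted_wrt_cut_points[of v], of i j]
    sorted_wrt_nth_less[OF sorted_wrt_cut_points[of v], of j i]
  by (cases i j rule: linorder_cases) (auto simp: length_cut_points)

lemma cut_points_le_iff:
  "\<lbrakk>i \<le> length (is_word v); j \<le> length (is_word v)\<rbrakk> \<Longrightarrow> cut_points v ! i \<le> cut_points v ! j \<longleftrightarrow> i \<le> j"
  using cut_points_less_iff[of j v i] by (simp add: linorder_not_less [symmetric])

lemma cut_points_less_length:
  "i < length (is_word v) \<Longrightarrow> cut_points v ! i < length v"
  using cut_points_less_iff[of i v "length (is_word v)"] by (simp add: cut_points_last)

lemma cut_points_le_length:
  "i \<le> length (is_word v) \<Longrightarrow> cut_points v ! i \<le> length v"
  using cut_points_le_iff[of i v "length (is_word v)"] by (simp add: cut_points_last)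

lemma locally_minimal_cut_point:
  assumes "i < length (is_word v)"
  shows "locally_minimal_at v (cut_points v ! i)"
proof -
  have "cut_points v ! i \<in> set (cut_points v)"
    using assms by (simp add: length_cut_points)
  moreover have "set (cut_points v) \<subseteq> insert (length v) {i. locally_minimal_at v i}"
    unfolding cut_points_def by fastforce
  ultimately show ?thesis
    using cut_points_less_length[OF assms] by auto
qed

lemma locally_minimal_less_length:
  assumes "locally_minimal_at v i"
  shows "i < length v"
proof -
  obtain j where "i + 1 \<le> j" "j < length v"
    using assms unfolding locally_minimal_at_def non_decreasing_at_def by blast
  then show ?thesis by simp
qed

lemma locally_minimal_obtain_cut_point:
  assumes "locally_minimal_at v i"
  obtains m where "m < length (is_word v)" "cut_points v ! m = i"
proof -
  have "i < length v"
    using assms by (rule locally_minimal_less_length)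
  then have "i \<in> set (cut_points v)"
    using assms by (simp add: cut_points_def)
  then obtain m where m: "m < length (cut_points v)" "cut_points v ! m = i"
    by (auto simp: in_set_conv_nth)
  moreover have "m \<noteq> length (is_word v)"
    using m \<open>i < length v\<close> cut_points_last[of v] by auto
  ultimately have "m < length (is_word v)"
    by (simp add: length_cut_points)
  then show ?thesis
    using m(2) by (rule that)
qed

text \<open>A local minimum is followed by an equal or larger letter, whereas a local minimum at
  \<open>Suc i\<close> would require a descent there.\<close>

lemma locally_minimal_not_adjacent:
  assumes "locally_minimal_at v i"
  shows "\<not> locally_minimal_at v (Suc i)"
proof
  assume "locally_minimal_at v (Suc i)"
  then have *: "v ! Suc i < v ! i"
    by (simp add: locally_minimal_at_def)
  obtain j where j: "i + 1 \<le> j" "\<forall>k\<in>{i..<j}. v ! k = v ! i" "v ! (j - 1) < v ! j"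
    using assms unfolding locally_minimal_at_def non_decreasing_at_def by blast
  show False
  proof (cases "j = Suc i")
    case True
    with j * show False by simp
  next
    case False
    with j(1) have "Suc i \<in> {i..<j}" by simp
    with j(2) have "v ! Suc i = v ! i" by blast
    with * show False by simp
  qed
qed

text \<open>This is what doubles the block length in every round. The last gap needs its own
  argument, as \<open>length v\<close> is not a local minimum: the ascent after a local minimum ends
  at some \<open>j < length v\<close>.\<close>

lemma cut_points_gap:
  assumes "i < length (is_word v)"
  shows "cut_points v ! i + 2 \<le> cut_points v ! Suc i"
proof -
  let ?c = "cut_points v ! i"
  have min: "locally_minimal_at v ?c"
    using assms by (rule locally_minimal_cut_point)
  have "?c < cut_points v ! Suc i"
    using assms by (simp add: cut_points_less_iff)
  moreover have "cut_points v ! Suc i \<noteq> Suc ?c"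
  proof (cases "Suc i = length (is_word v)")
    case True
    moreover obtain j where "?c + 1 \<le> j" "j < length v"
      using min unfolding locally_minimal_at_def non_decreasing_at_def by blast
    ultimately show ?thesis
      by (simp add: cut_points_last)
  next
    case False
    with assms have "locally_minimal_at v (cut_points v ! Suc i)"
      by (intro locally_minimal_cut_point) simp
    with locally_minimal_not_adjacent[OF min] show ?thesis by auto
  qed
  ultimately show ?thesis by simp
qed

section \<open>Equality of letters of \<open>is_word v\<close>\<close>

lemma nth_eis:
  "i < length (is_word v) \<Longrightarrow> eis v ! i = factor v (cut_points v ! i) (cut_points v ! Suc i)"
  by (simp add: eis_def length_cut_points)

lemma length_eis: "length (eis v) = length (is_word v)"
  by (simp add: is_word_def)

text \<open>Ranks in a finite linear order are strictly increasing, so replacing factors by ranks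
  identifies no two of them.\<close>

lemma is_word_eq_iff:
  assumes "i < length (is_word v)" "j < length (is_word v)"
  shows "is_word v ! i = is_word v ! j \<longleftrightarrow> eis v ! i = eis v ! j"
proof -
  define rank where "rank u = card {x \<in> set (eis v). x < u}" for u
  have less: "rank s < rank t" if "s < t" "s \<in> set (eis v)" for s t
    unfolding rank_def using that by (intro psubset_card_mono) auto
  have "inj_on rank (set (eis v))"
    by (rule inj_onI) (metis less less_irrefl neqE)
  moreover have "is_word v ! i = rank (eis v ! i)" "is_word v ! j = rank (eis v ! j)"
    using assms by (simp_all add: is_word_def rank_def)
  ultimately show ?thesis
    using assms by (auto simp: inj_on_eq_iff length_eis)
qed

lemma nth_factor: "t \<le> j - i \<Longrightarrow> i \<le> j \<Longrightarrow> factor v i j ! t = with_sentinel v ! (i + t)"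
  by (simp add: factor_def del: upt_Suc)

lemma length_factor: "length (factor v i j) = Suc j - i"
  by (simp add: factor_def del: upt_Suc)

lemma nth_with_sentinel: "i < length v \<Longrightarrow> with_sentinel v ! i = Some (v ! i)"
  by (simp add: with_sentinel_def nth_append)

text \<open>Equal factors have equal lengths, which gives \<open>d\<close>. The end letter of each
  factor is left out by \<open>t < d\<close>: it is the first letter of the next factor or the
  sentinel, and without it the factors become disjoint blocks.\<close>

lemma is_word_eqD:
  assumes "i < length (is_word v)" "j < length (is_word v)" "is_word v ! i = is_word v ! j"
  obtains d where "cut_points v ! Suc i = cut_points v ! i + d"
    "cut_points v ! Suc j = cut_points v ! j + d"
    "\<And>t. t < d \<Longrightarrow> v ! (cut_points v ! i + t) = v ! (cut_points v ! j + t)"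
proof -
  let ?c = "cut_points v"
  define d where "d = ?c ! Suc i - ?c ! i"
  have eq: "factor v (?c ! i) (?c ! Suc i) = factor v (?c ! j) (?c ! Suc j)"
    using assms by (simp add: is_word_eq_iff nth_eis)
  have le: "?c ! i \<le> ?c ! Suc i" "?c ! j \<le> ?c ! Suc j"
    using cut_points_gap[OF assms(1)] cut_points_gap[OF assms(2)] by auto
  have len: "?c ! Suc i \<le> length v" "?c ! Suc j \<le> length v"
    using assms by (auto intro: cut_points_le_length)
  have d: "?c ! Suc i = ?c ! i + d" "?c ! Suc j = ?c ! j + d"
    using arg_cong[OF eq, of length] le by (auto simp: length_factor d_def)
  moreover have "v ! (?c ! i + t) = v ! (?c ! j + t)" if "t < d" for t
  proof -
    have "with_sentinel v ! (?c ! i + t) = with_sentinel v ! (?c ! j + t)"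
      using arg_cong[OF eq, of "\<lambda>u. u ! t"] that d by (simp add: nth_factor)
    moreover have "?c ! i + t < length v" "?c ! j + t < length v"
      using that d len by auto
    ultimately show ?thesis by (simp add: nth_with_sentinel)
  qed
  ultimately show ?thesis using that by blast
qed

section \<open>Blocks of the input word\<close>

text \<open>The list \<open>ps\<close> holds the positions in \<open>w\<close> at which the blocks represented by the letters of
  \<open>v\<close> start, followed by the end position of the last block.\<close>

definition parsing :: "'c list \<Rightarrow> nat \<Rightarrow> 'b list \<Rightarrow> nat list \<Rightarrow> bool" where
  "parsing w g v ps \<longleftrightarrow>
     length ps = Suc (length v) \<and> ps ! length v = length w \<and>
     (\<forall>i<length v. ps ! i + g \<le> ps ! Suc i) \<and>
     (\<forall>i<length v. \<forall>j<length v. v ! i = v ! j \<longrightarrow>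
        (\<exists>L. ps ! Suc i = ps ! i + L \<and> ps ! Suc j = ps ! j + L \<and>
             (\<forall>t<L. w ! (ps ! i + t) = w ! (ps ! j + t))))"

lemma parsing_add_le:
  assumes "parsing w g v ps" "i + d \<le> length v"
  shows "ps ! i + d * g \<le> ps ! (i + d)"
  using assms(2)
proof (induction d)
  case (Suc d)
  have "ps ! (i + d) + g \<le> ps ! Suc (i + d)"
    using assms(1) Suc.prems by (auto simp: parsing_def)
  with Suc show ?case by simp
qed simp

lemma parsing_mono:
  assumes "parsing w g v ps" "i \<le> j" "j \<le> length v"
  shows "ps ! i \<le> ps ! j"
  using parsing_add_le[OF assms(1), of i "j - i"] assms(2,3) by simp

text \<open>Blocks of equal letters are glued one after the other; having equal lengths, they keep
  the two runs aligned.\<close>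

lemma parsing_equal_runs:
  assumes "parsing w g v ps" "i + d \<le> length v" "j + d \<le> length v"
    and "\<And>t. t < d \<Longrightarrow> v ! (i + t) = v ! (j + t)"
  shows "\<exists>L. ps ! (i + d) = ps ! i + L \<and> ps ! (j + d) = ps ! j + L \<and>
             (\<forall>t<L. w ! (ps ! i + t) = w ! (ps ! j + t))"
  using assms(2-)
proof (induction d)
  case (Suc d)
  have "\<exists>L. ps ! (i + d) = ps ! i + L \<and> ps ! (j + d) = ps ! j + L \<and>
      (\<forall>t<L. w ! (ps ! i + t) = w ! (ps ! j + t))"
    by (rule Suc.IH) (use Suc.prems in auto)
  then obtain L where L: "ps ! (i + d) = ps ! i + L" "ps ! (j + d) = ps ! j + L"
    "\<forall>t<L. w ! (ps ! i + t) = w ! (ps ! j + t)"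
    by blast
  have "i + d < length v" "j + d < length v" "v ! (i + d) = v ! (j + d)"
    using Suc.prems by auto
  then obtain L' where L': "ps ! Suc (i + d) = ps ! (i + d) + L'"
    "ps ! Suc (j + d) = ps ! (j + d) + L'"
    "\<forall>t<L'. w ! (ps ! (i + d) + t) = w ! (ps ! (j + d) + t)"
    using assms(1) unfolding parsing_def by blast
  have "w ! (ps ! i + t) = w ! (ps ! j + t)" if "t < L + L'" for t
  proof (cases "t < L")
    case False
    with that have "t - L < L'" by simp
    with L'(3) have "w ! (ps ! (i + d) + (t - L)) = w ! (ps ! (j + d) + (t - L))"
      by blast
    with False L(1,2) show ?thesis by simp
  qed (use L in simp)
  with L L' show ?case
    by (intro exI[of _ "L + L'"]) auto
qed simp

text \<open>One round of the algorithm: a new block is a concatenation of at least two old ones, and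
  equal new letters stand for equal runs of old letters.\<close>

lemma parsing_is_word:
  assumes "parsing w g v ps"
  shows "parsing w (2 * g) (is_word v) (map ((!) ps) (cut_points v))"
proof -
  let ?c = "cut_points v" and ?ps = "map ((!) ps) (cut_points v)"
  have nth: "?ps ! i = ps ! (?c ! i)" if "i \<le> length (is_word v)" for i
    using that by (simp add: length_cut_points)
  have "?ps ! i + 2 * g \<le> ?ps ! Suc i" if "i < length (is_word v)" for i
  proof -
    have "?c ! i + 2 \<le> ?c ! Suc i" "?c ! Suc i \<le> length v"
      using that by (simp_all only: cut_points_gap cut_points_le_length Suc_leI)
    then have "ps ! (?c ! i) + 2 * g \<le> ps ! (?c ! i + 2)" "ps ! (?c ! i + 2) \<le> ps ! (?c ! Suc i)"
      using parsing_add_le[OF assms, of "?c ! i" 2] parsing_mono[OF assms] by auto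
    then show ?thesis using that nth by simp
  qed
  moreover have "\<exists>L. ?ps ! Suc i = ?ps ! i + L \<and> ?ps ! Suc j = ?ps ! j + L \<and>
      (\<forall>t<L. w ! (?ps ! i + t) = w ! (?ps ! j + t))"
    if ij: "i < length (is_word v)" "j < length (is_word v)" "is_word v ! i = is_word v ! j" for i j
  proof -
    obtain d where d: "?c ! Suc i = ?c ! i + d" "?c ! Suc j = ?c ! j + d"
      "\<And>t. t < d \<Longrightarrow> v ! (?c ! i + t) = v ! (?c ! j + t)"
      using is_word_eqD[OF ij] by blast
    have "?c ! i + d \<le> length v" "?c ! j + d \<le> length v"
      using cut_points_le_length[of "Suc i" v] cut_points_le_length[of "Suc j" v] d(1,2) ij by auto
    from parsing_equal_runs[OF assms this d(3)] show ?thesis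
      using d(1,2) ij nth by simp
  qed
  moreover have "?ps ! length (is_word v) = length w"
    using assms by (simp add: nth cut_points_last parsing_def)
  ultimately show ?thesis
    by (auto simp: parsing_def length_cut_points)
qed

lemma parsing_self: "parsing w 1 w [0..<Suc (length w)]"
proof -
  have "[0..<Suc (length w)] ! i = i" if "i \<le> length w" for i
    using that by (simp del: upt_Suc)
  then show ?thesis
    by (auto simp: parsing_def simp del: upt_Suc intro!: exI[of _ 1])
qed

section \<open>Propagation of a period through one round\<close>

lemma non_decreasing_atI:
  assumes "i + 1 \<le> j" "j < length v" "\<And>k. k \<in> {i..<j} \<Longrightarrow> v ! k = v ! i" "v ! (j - 1) < v ! j"
  shows "non_decreasing_at v i"
  unfolding non_decreasing_at_def using assms by blast

text \<open>Local minimality at \<open>i\<close> is decided by the letters from \<open>i - 1\<close>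
  up to the first letter after \<open>i\<close> that differs from \<open>v ! i\<close>. At a local
  minimum the latter comes less than \<open>q\<close> positions later, because
  \<open>i - 1 + q\<close> repeats the larger letter at \<open>i - 1\<close>. So these letters stay
  inside the stretch and move along with the period.\<close>

lemma locally_minimal_shift:
  assumes per: "\<And>k. x \<le> k \<Longrightarrow> k + q < y \<Longrightarrow> v ! (k + q) = v ! k"
    and y: "y \<le> length v" and i: "x < i" "i + 2 * q \<le> y" and "0 < q"
  shows "locally_minimal_at v (i + q) \<longleftrightarrow> locally_minimal_at v i"
proof -
  have pred: "v ! (i + q - 1) = v ! (i - 1)" "v ! (i + q) = v ! i"
    using per[of "i - 1"] per[of i] i \<open>0 < q\<close> by auto
  have close: "j < k + q"
    if "locally_minimal_at v k" "\<And>l. l \<in> {k..<j} \<Longrightarrow> v ! l = v ! k" "x < k" "k + q \<le> y" for j k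
  proof (rule ccontr)
    assume "\<not> j < k + q"
    with \<open>0 < q\<close> have "v ! (k + q - 1) = v ! k"
      by (intro that(2)) auto
    moreover have "v ! (k - 1 + q) = v ! (k - 1)"
      using that \<open>0 < q\<close> by (intro per) auto
    ultimately show False
      using that(1,3) by (simp add: locally_minimal_at_def)
  qed
  show ?thesis
  proof
    assume min: "locally_minimal_at v (i + q)"
    then obtain j where j: "i + q + 1 \<le> j" "j < length v"
        "\<And>k. k \<in> {i + q..<j} \<Longrightarrow> v ! k = v ! (i + q)" "v ! (j - 1) < v ! j"
      unfolding locally_minimal_at_def non_decreasing_at_def by blast
    have "j < i + q + q"
      by (rule close[OF min j(3)]) (use i in auto)
    have shift: "v ! k = v ! (k + q)" if "x \<le> k" "k + q \<le> j" for k
      using per[of k] that \<open>j < i + q + q\<close> i by simp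
    have "non_decreasing_at v i"
    proof (rule non_decreasing_atI)
      show "i + 1 \<le> j - q" "j - q < length v"
        using j(1,2) by auto
      show "v ! k = v ! i" if "k \<in> {i..<j - q}" for k
        using j(3)[of "k + q"] shift[of k] that i pred(2) by auto
      show "v ! (j - q - 1) < v ! (j - q)"
        using j(1,4) shift[of "j - q - 1"] shift[of "j - q"] i by auto
    qed
    with min pred i show "locally_minimal_at v i"
      by (simp add: locally_minimal_at_def)
  next
    assume min: "locally_minimal_at v i"
    then obtain j where j: "i + 1 \<le> j" "j < length v"
        "\<And>k. k \<in> {i..<j} \<Longrightarrow> v ! k = v ! i" "v ! (j - 1) < v ! j"
      unfolding locally_minimal_at_def non_decreasing_at_def by blast
    have "j < i + q"
      by (rule close[OF min j(3)]) (use i in auto)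
    have shift: "v ! k = v ! (k + q)" if "x \<le> k" "k \<le> j" for k
      using per[of k] that \<open>j < i + q\<close> i by simp
    have "non_decreasing_at v (i + q)"
    proof (rule non_decreasing_atI)
      show "i + q + 1 \<le> j + q" "j + q < length v"
        using j(1) \<open>j < i + q\<close> i y by auto
      show "v ! k = v ! (i + q)" if "k \<in> {i + q..<j + q}" for k
      proof -
        have "x \<le> k - q" "k - q \<le> j" "k - q \<in> {i..<j}" "k - q + q = k"
          using that i by auto
        then show ?thesis
          using j(3)[of "k - q"] shift[of "k - q"] pred(2) by simp
      qed
      show "v ! (j + q - 1) < v ! (j + q)"
        using j(1,4) shift[of "j - 1"] shift[of "j"] i by auto
    qed
    with min pred i show "locally_minimal_at v (i + q)"
      by (simp add: locally_minimal_at_def)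
  qed
qed

text \<open>Both end positions belong to a factor, so the later factor must end strictly before
  \<open>y\<close>; this also keeps the sentinel out.\<close>

lemma is_word_shift:
  assumes per: "\<And>k. x \<le> k \<Longrightarrow> k + q < y \<Longrightarrow> v ! (k + q) = v ! k"
    and "y \<le> length v" "m < length (is_word v)" "m' < length (is_word v)"
    and "cut_points v ! m' = cut_points v ! m + q" "cut_points v ! Suc m' = cut_points v ! Suc m + q"
    and "x \<le> cut_points v ! m" "cut_points v ! Suc m' < y"
  shows "is_word v ! m' = is_word v ! m"
proof -
  let ?c = "cut_points v"
  have le: "?c ! m \<le> ?c ! Suc m"
    using cut_points_gap[OF assms(3)] by simp
  have "with_sentinel v ! (?c ! m' + t) = with_sentinel v ! (?c ! m + t)"
    if "t \<le> ?c ! Suc m - ?c ! m" for t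
  proof -
    have "?c ! m' + t \<le> ?c ! Suc m'"
      using that le assms(5,6) by simp
    then have "?c ! m' + t < y"
      using assms(8) by simp
    then have "?c ! m' + t < length v" "?c ! m + t < length v"
      using assms(2,5) by auto
    then show ?thesis
      using per[of "?c ! m + t"] assms(5,7) \<open>?c ! m' + t < y\<close>
      by (simp add: nth_with_sentinel add.assoc add.commute add.left_commute)
  qed
  then have "factor v (?c ! m') (?c ! Suc m') = factor v (?c ! m) (?c ! Suc m)"
    using le assms(5,6) by (intro nth_equalityI) (auto simp: length_factor nth_factor less_Suc_eq_le Suc_diff_le)
  then show ?thesis
    using assms(3,4) by (simp add: is_word_eq_iff nth_eis)
qed

text \<open>The invariant for a \<open>p\<close>-periodic stretch \<open>{a..<b}\<close> of the input: up to an error \<open>C\<close> at both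
  ends, either no block starts inside the stretch, or the letters representing it have some
  period \<open>q\<close>, and \<open>q\<close> consecutive blocks cover exactly \<open>p\<close> letters of the input.\<close>

definition repetitive_or_sparse ::
  "nat \<Rightarrow> nat \<Rightarrow> nat \<Rightarrow> nat \<Rightarrow> 'b list \<Rightarrow> nat list \<Rightarrow> bool" where
  "repetitive_or_sparse a b p C v ps \<longleftrightarrow>
     (\<forall>i<length v. ps ! i \<le> a + C \<or> b \<le> ps ! i + C) \<or>
     (\<exists>q x y. 0 < q \<and> x + q \<le> y \<and> y \<le> length v \<and> ps ! x \<le> a + C \<and> b \<le> ps ! y + C \<and>
        (\<forall>i. x \<le> i \<and> i + q < y \<longrightarrow> v ! (i + q) = v ! i) \<and>
        (\<forall>i. x \<le> i \<and> i + q \<le> y \<longrightarrow> ps ! (i + q) = ps ! i + p))"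

text \<open>Away from the ends of the stretch the cut points inherit the period \<open>q\<close>.
  Either none lies there, or they recur with \<open>q'\<close> of them per \<open>q\<close> letters
  of \<open>v\<close>, that is, per \<open>p\<close> letters of \<open>w\<close>. At most two
  periods are lost at each end, which adds \<open>2 * p\<close> to the error.\<close>

lemma repetitive_or_sparse_is_word:
  assumes pars: "parsing w g v ps" and "repetitive_or_sparse a b p C v ps"
  shows "repetitive_or_sparse a b p (C + 2 * p) (is_word v) (map ((!) ps) (cut_points v))"
proof -
  let ?c = "cut_points v" and ?ps = "map ((!) ps) (cut_points v)" and ?l = "length (is_word v)"
  have nth: "?ps ! i = ps ! (?c ! i)" if "i \<le> ?l" for i
    using that by (simp add: length_cut_points)
  note mono = parsing_mono[OF pars]
  consider (sparse) "\<forall>i<length v. ps ! i \<le> a + C \<or> b \<le> ps ! i + C"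
    | (per) q x y where "0 < q" "x + q \<le> y" "y \<le> length v" "ps ! x \<le> a + C" "b \<le> ps ! y + C"
        "\<And>i. x \<le> i \<Longrightarrow> i + q < y \<Longrightarrow> v ! (i + q) = v ! i"
        "\<And>i. x \<le> i \<Longrightarrow> i + q \<le> y \<Longrightarrow> ps ! (i + q) = ps ! i + p"
    using assms(2) unfolding repetitive_or_sparse_def by blast
  then show ?thesis
  proof cases
    case sparse
    have "?ps ! i \<le> a + (C + 2 * p) \<or> b \<le> ?ps ! i + (C + 2 * p)" if "i < ?l" for i
      using sparse[rule_format, of "?c ! i"] that nth[of i] cut_points_less_length[OF that] by auto
    then show ?thesis by (simp add: repetitive_or_sparse_def)
  next
    case per
    have shift: "locally_minimal_at v (i + q) \<longleftrightarrow> locally_minimal_at v i"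
      if "x < i" "i + 2 * q \<le> y" for i
      using locally_minimal_shift[where v = v, OF per(6) per(3) that per(1)] .
    show ?thesis
    proof (cases "\<exists>m<?l. x < ?c ! m \<and> ?c ! m + 2 * q \<le> y")
      case no_cut: False
      have "?ps ! m \<le> a + (C + 2 * p) \<or> b \<le> ?ps ! m + (C + 2 * p)" if m: "m < ?l" for m
      proof (cases "?c ! m \<le> x")
        case True
        then have "ps ! (?c ! m) \<le> ps ! x"
          using per by (intro mono) auto
        with per(4) nth m show ?thesis by simp
      next
        case False
        with no_cut m have y: "y < ?c ! m + 2 * q" by force
        show ?thesis
        proof (cases "x + 2 * q \<le> y")
          case True
          have "ps ! (y - 2 * q + q) = ps ! (y - 2 * q) + p"
            "ps ! (y - 2 * q + q + q) = ps ! (y - 2 * q + q) + p"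
            using True by (intro per(7); simp)+
          moreover have "y - 2 * q + q + q = y"
            using True by simp
          moreover have "ps ! (y - 2 * q) \<le> ps ! (?c ! m)"
            using y m cut_points_less_length[OF m] by (intro mono) auto
          ultimately have "b \<le> ps ! (?c ! m) + (C + 2 * p)"
            using per(5) by simp
          then show ?thesis using nth m by simp
        next
          \<comment> \<open>In a stretch this short the two error zones together cover every
            position.\<close>
          case False
          have "ps ! (y - q + q) = ps ! (y - q) + p" "ps ! (x + q) = ps ! x + p"
            using per(2) by (intro per(7); simp)+
          moreover have "ps ! (y - q) \<le> ps ! (x + q)"
            using False per(2,3) by (intro mono) auto
          ultimately have "ps ! y \<le> ps ! x + 2 * p"
            using per(2) by simp
          then have "b \<le> a + C + (C + 2 * p)"
            using per(4,5) by simp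
          then show ?thesis by linarith
        qed
      qed
      then show ?thesis by (simp add: repetitive_or_sparse_def)
    next
      case True
      define m0 where "m0 = (LEAST m. m < ?l \<and> x < ?c ! m \<and> ?c ! m + 2 * q \<le> y)"
      have m0: "m0 < ?l" "x < ?c ! m0" "?c ! m0 + 2 * q \<le> y"
        using LeastI_ex[OF True] by (auto simp: m0_def)
      have first: "m0 \<le> m" if "m < ?l" "x < ?c ! m" "?c ! m + 2 * q \<le> y" for m
        unfolding m0_def using that by (intro Least_le) auto
      have min0: "locally_minimal_at v (?c ! m0)"
        using m0 by (intro locally_minimal_cut_point)
      have "locally_minimal_at v (?c ! m0 + q)"
        using shift[of "?c ! m0"] m0 min0 by simp
      then obtain m1 where m1: "m1 < ?l" "?c ! m1 = ?c ! m0 + q"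
        by (rule locally_minimal_obtain_cut_point)
      have "m0 < m1"
        using cut_points_less_iff[of m0 v m1] m0 m1 per(1) by simp
      \<comment> \<open>The new period is the number of cut points in one period of
        \<open>v\<close>, counted from the first cut point inside the stretch.\<close>
      define q' where "q' = m1 - m0"
      have q': "0 < q'" "m1 = m0 + q'"
        using \<open>m0 < m1\<close> by (auto simp: q'_def)
      \<comment> \<open>Induction along the cut points: the successor of the cut point
        \<open>m + q'\<close>, shifted back by \<open>q\<close>, is a cut point after
        \<open>m\<close>, and the successor of \<open>m\<close>, shifted forward, is one after
        \<open>m + q'\<close>. Hence the two successors differ by exactly \<open>q\<close>.\<close>
      have cuts: "?c ! (m + q') = ?c ! m + q"
        if "m0 \<le> m" "m + q' \<le> ?l" "?c ! (m + q') + q \<le> y" for m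
        using that
      proof (induction m rule: dec_induct)
        case base
        then show ?case using m1 q' by simp
      next
        case (step m)
        let ?m = "m + q'"
        have lt: "?c ! ?m < ?c ! Suc ?m" "?c ! m < ?c ! Suc m" "?c ! m0 \<le> ?c ! m"
          using step by (simp_all add: cut_points_less_iff cut_points_le_iff)
        have eq: "?c ! ?m = ?c ! m + q"
          using step lt by simp
        \<comment> \<open>The final entry \<open>length v\<close> is no local minimum; it is
          excluded because a further \<open>q\<close> letters must fit before
          \<open>y\<close>.\<close>
        have "Suc ?m \<noteq> ?l"
          using step.prems per(1,3) by (auto simp: cut_points_last)
        with step.prems have "Suc ?m < ?l" by simp
        define i where "i = ?c ! Suc ?m - q"
        have i: "?c ! m < i" "i + q = ?c ! Suc ?m"
          using lt eq by (auto simp: i_def)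
        have "locally_minimal_at v (i + q)"
          unfolding i(2) using \<open>Suc ?m < ?l\<close> by (rule locally_minimal_cut_point)
        then have "locally_minimal_at v i"
          using shift[of i] i lt m0 step.prems by simp
        then obtain m' where m': "m' < ?l" "?c ! m' = i"
          by (rule locally_minimal_obtain_cut_point)
        have "m < m'"
          using m' i cut_points_less_iff[of m v m'] \<open>Suc ?m < ?l\<close> by simp
        then have le: "?c ! Suc m \<le> i"
          using m' cut_points_le_iff[of "Suc m" v m'] by simp
        have "locally_minimal_at v (?c ! Suc m)"
          using \<open>Suc ?m < ?l\<close> by (intro locally_minimal_cut_point) simp
        then have "locally_minimal_at v (?c ! Suc m + q)"
          using shift[of "?c ! Suc m"] le i lt m0 step.prems by simp
        then obtain m'' where m'': "m'' < ?l" "?c ! m'' = ?c ! Suc m + q"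
          by (rule locally_minimal_obtain_cut_point)
        have "?m < m''"
          using m'' lt eq cut_points_less_iff[of ?m v m''] \<open>Suc ?m < ?l\<close> by simp
        then have "?c ! Suc ?m \<le> ?c ! Suc m + q"
          using m'' cut_points_le_iff[of "Suc ?m" v m''] by simp
        with le i show ?case by simp
      qed
      \<comment> \<open>\<open>t\<close> is the first cut point closer than \<open>q\<close> to
        \<open>y\<close> or past it. Its predecessor \<open>y'\<close> ends the new stretch, so that
        all factors of that stretch end inside the old one.\<close>
      define t where "t = (LEAST t. y < ?c ! t + q)"
      have last: "y < ?c ! ?l + q"
        using per(1,3) by (simp add: cut_points_last)
      have t: "y < ?c ! t + q" "t \<le> ?l"
        unfolding t_def using last by (auto intro: LeastI Least_le)
      have before: "?c ! m + q \<le> y" if "m < t" for m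
        using not_less_Least[of m "\<lambda>t. y < ?c ! t + q"] that by (simp add: t_def)
      have m1t: "m1 < t"
        using t cut_points_less_iff[of m1 v t] m1 m0 by simp
      define y' where "y' = t - 1"
      have y': "t = Suc y'"
        using m1t by (simp add: y'_def)
      have "x \<le> ?c ! m" if "m0 \<le> m" "m \<le> ?l" for m
        using that m0 cut_points_le_iff[of m0 v m] by simp
      then have per_word: "is_word v ! (m + q') = is_word v ! m" if "m0 \<le> m" "m + q' < y'" for m
        using that q' cuts[of m] cuts[of "Suc m"] before[of "m + q'"] before[of "Suc (m + q')"] y' t per(1)
        by (intro is_word_shift[where v = v, OF per(6) per(3)]) auto
      have per_ps: "?ps ! (m + q') = ?ps ! m + p" if "m0 \<le> m" "m + q' \<le> y'" for m
      proof -
        have "m + q' < t"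
          using that y' by simp
        then have c: "?c ! (m + q') = ?c ! m + q" "?c ! m + q + q \<le> y"
          using cuts[of m] before[of "m + q'"] that t by auto
        have "x \<le> ?c ! m"
          using that m0 cut_points_le_iff[of m0 v m] y' t by simp
        then show ?thesis
          using c per(7)[of "?c ! m"] nth[of m] nth[of "m + q'"] \<open>m + q' < t\<close> t by simp
      qed
      \<comment> \<open>Otherwise a shift back by \<open>q\<close> would give an earlier cut point
        inside the stretch.\<close>
      have "?c ! m0 \<le> x + q"
      proof (rule ccontr)
        assume "\<not> ?c ! m0 \<le> x + q"
        then have "locally_minimal_at v (?c ! m0 - q)"
          using shift[of "?c ! m0 - q"] m0 min0 by simp
        then obtain m where m: "m < ?l" "?c ! m = ?c ! m0 - q"
          by (rule locally_minimal_obtain_cut_point)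
        then have "m0 \<le> m"
          using first[of m] m0 \<open>\<not> ?c ! m0 \<le> x + q\<close> by simp
        then show False
          using m m0 cut_points_le_iff[of m0 v m] \<open>\<not> ?c ! m0 \<le> x + q\<close> per(1) by simp
      qed
      then have "ps ! (?c ! m0) \<le> ps ! (x + q)"
        using per by (intro mono) auto
      then have left: "?ps ! m0 \<le> a + (C + 2 * p)"
        using per(2,4) per(7)[of x] nth[of m0] m0 by simp
      \<comment> \<open>Otherwise a shift forward by \<open>q\<close> would give a cut point after
        \<open>y'\<close>, hence not before \<open>t\<close>, that still leaves \<open>q\<close>
        letters up to \<open>y\<close>.\<close>
      have "y < ?c ! y' + 2 * q"
      proof (rule ccontr)
        assume far: "\<not> y < ?c ! y' + 2 * q"
        have "x < ?c ! y'"
          using m0 y' m1t \<open>m0 < m1\<close> t cut_points_le_iff[of m0 v y'] by simp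
        moreover have "locally_minimal_at v (?c ! y')"
          using y' t by (intro locally_minimal_cut_point) simp
        ultimately have "locally_minimal_at v (?c ! y' + q)"
          using shift[of "?c ! y'"] far by simp
        then obtain m where m: "m < ?l" "?c ! m = ?c ! y' + q"
          by (rule locally_minimal_obtain_cut_point)
        then have "y' < m"
          using cut_points_less_iff[of y' v m] y' t per(1) by simp
        then have "?c ! t \<le> ?c ! m"
          using cut_points_le_iff[of t v m] y' t m by simp
        then show False
          using t m far by simp
      qed
      then have "ps ! (y - 2 * q) \<le> ps ! (?c ! y')"
        using cut_points_le_length[of y' v] y' t by (intro mono) auto
      moreover have "ps ! (y - 2 * q + q) = ps ! (y - 2 * q) + p"
        "ps ! (y - 2 * q + q + q) = ps ! (y - 2 * q + q) + p"
        using m0 by (intro per(7); simp)+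
      moreover have "y - 2 * q + q + q = y"
        using m0 by simp
      ultimately have right: "b \<le> ?ps ! y' + (C + 2 * p)"
        using per(5) nth[of y'] y' t by simp
      have "m0 + q' \<le> y'" "y' \<le> ?l"
        using q' m1t y' t by auto
      then show ?thesis
        using q'(1) left right per_word per_ps
        unfolding repetitive_or_sparse_def by blast
    qed
  qed
qed

lemma repetitive_or_sparse_self:
  assumes "b \<le> length w" "0 < p" "\<And>i. a \<le> i \<Longrightarrow> i + p < b \<Longrightarrow> w ! (i + p) = w ! i"
  shows "repetitive_or_sparse a b p p w [0..<Suc (length w)]"
proof -
  have nth: "[0..<Suc (length w)] ! i = i" if "i \<le> length w" for i
    using that by (simp del: upt_Suc)
  show ?thesis
  proof (cases "a + p \<le> b")
    case True
    then show ?thesis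
      using assms unfolding repetitive_or_sparse_def
      by (intro disjI2 exI[of _ p] exI[of _ a] exI[of _ b]) (auto simp: nth simp del: upt_Suc)
  next
    case False
    then show ?thesis
      unfolding repetitive_or_sparse_def by (auto simp: nth simp del: upt_Suc)
  qed
qed

text \<open>At least one block, of length at least \<open>g\<close>, would have to fit into
  \<open>p < g\<close> letters, so the repetitive alternative is impossible.\<close>

lemma repetitive_or_sparse_gap:
  assumes "parsing w g v ps" "repetitive_or_sparse a b p C v ps" "p < g" "i < length v"
  shows "ps ! i \<le> a + C \<or> b \<le> ps ! i + C"
proof (rule ccontr)
  assume "\<not> ?thesis"
  with assms(2,4) obtain q x y where *: "0 < q" "x + q \<le> y" "y \<le> length v"
    "\<forall>i. x \<le> i \<and> i + q \<le> y \<longrightarrow> ps ! (i + q) = ps ! i + p"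
    unfolding repetitive_or_sparse_def by blast
  then have "ps ! x + q * g \<le> ps ! x + p"
    using parsing_add_le[OF assms(1), of x q] by simp
  moreover have "1 * g \<le> q * g"
    using *(1) by (intro mult_right_mono) auto
  ultimately show False
    using assms(3) by simp
qed

section \<open>Long repetitions in trajectories\<close>

lemma is_rec_calls_nat_parsing:
  assumes "parsing w g v ps" "repetitive_or_sparse a b p C v ps"
    and "\<not> distinct v" "r \<le> is_rec_calls_nat v"
  shows "\<exists>v' ps'. \<not> distinct (v' :: nat list) \<and> parsing w (2 ^ r * g) v' ps' \<and>
           repetitive_or_sparse a b p (C + 2 * p * r) v' ps'"
  using assms
proof (induction r arbitrary: g C v ps)
  case 0
  then show ?case by auto
next
  case (Suc r)
  have "is_rec_calls_nat v = (if distinct (is_word v) then 0 else 1 + is_rec_calls_nat (is_word v))"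
    by (rule is_rec_calls_nat.simps)
  with Suc.prems(4) have "\<not> distinct (is_word v)" "r \<le> is_rec_calls_nat (is_word v)"
    by (auto split: if_splits)
  from Suc.IH[OF parsing_is_word[OF Suc.prems(1)]
      repetitive_or_sparse_is_word[OF Suc.prems(1,2)] this]
  show ?case by (simp add: algebra_simps)
qed

text \<open>The first round works on the input alphabet, the other \<open>r - 1\<close> rounds on
  words over \<open>nat\<close>. Only the later of the two equal blocks is located; this serves both
  reading directions.\<close>

lemma is_rec_calls_repeated_block:
  assumes calls: "r \<le> is_rec_calls w" "0 < r"
    and per: "b \<le> length w" "0 < p" "\<And>i. a \<le> i \<Longrightarrow> i + p < b \<Longrightarrow> w ! (i + p) = w ! i"
    and "p < 2 ^ r"
  obtains s s' where "s + 2 ^ r \<le> s'" "s' + 2 ^ r \<le> length w"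
    "\<And>t. t < 2 ^ r \<Longrightarrow> w ! (s + t) = w ! (s' + t)"
    "s' \<le> a + (p + 2 * p * r) \<or> b \<le> s' + (p + 2 * p * r)"
proof -
  let ?C = "p + 2 * p * r"
  obtain r' where r': "r = Suc r'"
    using \<open>0 < r\<close> by (cases r) auto
  have "is_rec_calls w = (if distinct (is_word w) then 0 else 1 + is_rec_calls_nat (is_word w))"
    by (rule is_rec_calls_def)
  with calls r' have nd: "\<not> distinct (is_word w)" "r' \<le> is_rec_calls_nat (is_word w)"
    by (auto split: if_splits)
  have "repetitive_or_sparse a b p p w [0..<Suc (length w)]"
    using per by (rule repetitive_or_sparse_self)
  from is_rec_calls_nat_parsing[OF parsing_is_word[OF parsing_self]
      repetitive_or_sparse_is_word[OF parsing_self this] nd]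
  have "\<exists>v ps. \<not> distinct (v :: nat list) \<and> parsing w (2 ^ r' * (2 * 1)) v ps \<and>
      repetitive_or_sparse a b p (p + 2 * p + 2 * p * r') v ps" .
  moreover have "2 ^ r' * (2 * 1) = (2 ^ r :: nat)" "p + 2 * p + 2 * p * r' = ?C"
    by (simp_all add: r')
  ultimately obtain v :: "nat list" and ps where v: "\<not> distinct v" "parsing w (2 ^ r) v ps"
    "repetitive_or_sparse a b p ?C v ps"
    by metis
  then obtain i j where ij: "i < j" "j < length v" "v ! i = v ! j"
    by (metis distinct_conv_nth nat_neq_iff)
  then obtain L where L: "ps ! Suc i = ps ! i + L" "ps ! Suc j = ps ! j + L"
    "\<forall>t<L. w ! (ps ! i + t) = w ! (ps ! j + t)"
    using v(2) unfolding parsing_def by (meson less_trans)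
  have gap: "ps ! k + 2 ^ r \<le> ps ! Suc k" if "k < length v" for k
    using v(2) that by (simp add: parsing_def)
  have "ps ! i + 2 ^ r \<le> ps ! Suc i" "ps ! j + 2 ^ r \<le> ps ! Suc j"
    using gap ij by simp_all
  moreover have "ps ! Suc i \<le> ps ! j" "ps ! Suc j \<le> ps ! length v"
    using ij by (intro parsing_mono[OF v(2)]; simp)+
  moreover have "ps ! length v = length w"
    using v(2) by (simp add: parsing_def)
  moreover have "ps ! j \<le> a + ?C \<or> b \<le> ps ! j + ?C"
    using repetitive_or_sparse_gap[OF v(2,3) \<open>p < 2 ^ r\<close> ij(2)] .
  ultimately show ?thesis
    using L by (intro that[of "ps ! i" "ps ! j"]) auto
qed

text \<open>Take the first run of \<open>CARD('a)\<close> states in \<open>D\<close>. By the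
  pigeonhole principle some state recurs within the run and the position after it, and determinism
  then repeats this loop up to the end of the list. Before the run every window of that length
  leaves \<open>D\<close>.\<close>

lemma eventually_periodic_trajectory:
  fixes xs :: "'a::finite list"
  assumes det: "\<And>i. Suc i < length xs \<Longrightarrow> xs ! i \<in> D \<Longrightarrow> xs ! Suc i = f (xs ! i)"
  obtains a p where "a \<le> length xs" "0 < p" "p \<le> CARD('a)"
    "\<And>i. a \<le> i \<Longrightarrow> i + p < length xs \<Longrightarrow> xs ! (i + p) = xs ! i"
    "\<And>t. t + 2 * CARD('a) \<le> a \<Longrightarrow> \<exists>u<CARD('a). xs ! (t + u) \<notin> D"
proof -
  let ?K = "CARD('a)" and ?n = "length xs"
  let ?Q = "\<lambda>z. z + ?K < ?n \<and> (\<forall>u<?K. xs ! (z + u) \<in> D)"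
  have K: "0 < ?K" by (simp add: card_gt_0_iff)
  show ?thesis
  proof (cases "\<exists>z. ?Q z")
    case False
    \<comment> \<open>Without such a run the periodic part is empty, and the period 1 holds
      vacuously.\<close>
    show ?thesis
    proof (rule that[of ?n 1])
      show "\<exists>u<?K. xs ! (t + u) \<notin> D" if "t + 2 * ?K \<le> ?n" for t
        using False that K by (metis add_less_cancel_left less_add_same_cancel1 less_le_trans mult_2)
    qed (use K in auto)
  next
    case True
    define z where "z = (LEAST z. ?Q z)"
    have z: "z + ?K < ?n" "\<And>u. u < ?K \<Longrightarrow> xs ! (z + u) \<in> D"
      using LeastI_ex[OF True] by (auto simp: z_def)
    have "\<not> inj_on ((!) xs) {z..z + ?K}"
    proof
      assume "inj_on ((!) xs) {z..z + ?K}"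
      then have "card {z..z + ?K} \<le> card (UNIV :: 'a set)"
        by (intro card_inj_on_le[of "(!) xs"]) auto
      then show False by simp
    qed
    then obtain i j where ij: "z \<le> i" "i < j" "j \<le> z + ?K" "xs ! i = xs ! j"
      unfolding inj_on_def by (metis atLeastAtMost_iff nat_neq_iff)
    define p where "p = j - i"
    have p: "j = i + p" "0 < p" "p \<le> ?K"
      using ij by (auto simp: p_def)
    have D: "xs ! m \<in> D" if "i \<le> m" "m < j" for m
      using z(2)[of "m - z"] that ij by simp
    \<comment> \<open>The two claims support each other: beyond the first loop, membership in
      \<open>D\<close> comes from position \<open>m - p\<close>; the period at \<open>m\<close>
      comes from applying \<open>f\<close> at \<open>m - 1\<close>.\<close>
    have cycle: "xs ! m \<in> D \<and> (m + p < ?n \<longrightarrow> xs ! (m + p) = xs ! m)" if "i \<le> m" "m < ?n" for m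
      using that
    proof (induction m rule: less_induct)
      case (less m)
      have "xs ! m \<in> D"
      proof (cases "m < j")
        case False
        then have "i \<le> m - p" "m - p < m" "m - p + p = m"
          using p by auto
        then show ?thesis
          using less.IH[of "m - p"] less.prems by simp
      qed (use D less in simp)
      moreover have "xs ! (m + p) = xs ! m" if "m + p < ?n"
      proof (cases "m = i")
        case True
        then show ?thesis using p ij by simp
      next
        case False
        with less.prems have m: "i \<le> m - 1" "m - 1 < m" "Suc (m - 1) = m" by auto
        then have IH: "xs ! (m - 1) \<in> D" "xs ! (m - 1 + p) = xs ! (m - 1)"
          using less.IH[of "m - 1"] less.prems that by auto
        have "xs ! Suc (m - 1 + p) = f (xs ! (m - 1 + p))"
          using that m IH by (intro det) auto
        moreover have "xs ! Suc (m - 1) = f (xs ! (m - 1))"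
          using less.prems m IH by (intro det) auto
        moreover have "Suc (m - 1 + p) = m + p"
          using m(3) by linarith
        ultimately show ?thesis
          using IH(2) m(3) by metis
      qed
      ultimately show ?case by blast
    qed
    show ?thesis
    proof (rule that[of i p])
      show "\<exists>u<?K. xs ! (t + u) \<notin> D" if "t + 2 * ?K \<le> i" for t
      proof -
        have "t < z"
          using that ij p K by simp
        then have "\<not> ?Q t"
          unfolding z_def by (rule not_less_Least)
        then show ?thesis
          using that ij z by auto
      qed
    qed (use ij z p cycle in auto)
  qed
qed

lemma card_ge_windows:
  assumes "\<And>j. j < R \<Longrightarrow> \<exists>u<K. Q (j * K + u)"
  shows "R \<le> card {u. u < R * K \<and> Q u}"
  using assms
proof (induction R)
  case (Suc R)
  obtain u where u: "u < K" "Q (R * K + u)"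
    using Suc.prems[of R] by auto
  have "Suc R \<le> card (insert (R * K + u) {u. u < R * K \<and> Q u})"
    using Suc by simp
  also have "\<dots> \<le> card {u. u < Suc R * K \<and> Q u}"
    using u by (intro card_mono) auto
  finally show ?case .
qed simp

text \<open>A state counts only if its outgoing transition also lies in the block; hence
  \<open>u + 1 < L\<close> leaves out the last position.\<close>

definition repeats_with_choices :: "'a set \<Rightarrow> nat \<Rightarrow> nat \<Rightarrow> (nat \<Rightarrow> 'a) \<Rightarrow> nat \<Rightarrow> nat \<Rightarrow> bool" where
  "repeats_with_choices D L R x t t' \<longleftrightarrow>
     (\<forall>u<L. x (t + u) = x (t' + u)) \<and> R \<le> card {u. u + 1 < L \<and> x (t + u) \<notin> D}"

text \<open>The deterministic loop ends the trajectory, so it is a suffix or a prefix of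
  \<open>w\<close>. In both cases the block starting at \<open>t\<close> ends by
  \<open>a + C\<close>, and up to there the windows of \<open>CARD('a)\<close> states contain states
  outside \<open>D\<close>, apart from a bounded margin.\<close>

lemma is_rec_calls_repeats:
  fixes xs :: "'a::{finite,linorder} list"
  assumes det: "\<And>i. Suc i < length xs \<Longrightarrow> xs ! i \<in> D \<Longrightarrow> xs ! Suc i = f (xs ! i)"
    and w: "w = xs \<or> w = rev xs"
    and calls: "r \<le> is_rec_calls w" "0 < r"
    and big: "CARD('a) * (R + 2 + 2 * r) \<le> 2 ^ r"
  shows "\<exists>t t'. t < t' \<and> t' + 2 ^ r \<le> length xs \<and> repeats_with_choices D (2 ^ r) R ((!) xs) t t'"
proof -
  let ?K = "CARD('a)" and ?n = "length xs"
  have K: "0 < ?K" by (simp add: card_gt_0_iff)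
  obtain a p where a: "a \<le> ?n" and p: "0 < p" "p \<le> ?K"
    and per: "\<And>i. a \<le> i \<Longrightarrow> i + p < ?n \<Longrightarrow> xs ! (i + p) = xs ! i"
    and choice: "\<And>t. t + 2 * ?K \<le> a \<Longrightarrow> \<exists>u<?K. xs ! (t + u) \<notin> D"
    using eventually_periodic_trajectory[of xs D f] det by blast
  define C where "C = p + 2 * p * r"
  have "p * (1 + 2 * r) \<le> ?K * (1 + 2 * r)"
    using p by (intro mult_right_mono) auto
  then have "C \<le> ?K + 2 * ?K * r"
    by (simp add: C_def algebra_simps)
  \<comment> \<open>A block has room for \<open>R\<close> windows, one more window as margin, and
    the error \<open>C\<close>.\<close>
  then have big': "R * ?K + ?K + C \<le> 2 ^ r"
    using big by (simp add: algebra_simps)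
  have "p < 2 ^ r"
    using big' p K by (simp add: C_def)
  have "\<exists>t t'. t < t' \<and> t' + 2 ^ r \<le> ?n \<and> t + 2 ^ r \<le> a + C \<and>
          (\<forall>u<2 ^ r. xs ! (t + u) = xs ! (t' + u))"
    using w
  proof
    assume "w = xs"
    then obtain s s' where s: "s + 2 ^ r \<le> s'" "s' + 2 ^ r \<le> ?n"
      "\<And>t. t < 2 ^ r \<Longrightarrow> xs ! (s + t) = xs ! (s' + t)" "s' \<le> a + C \<or> ?n \<le> s' + C"
      using is_rec_calls_repeated_block[OF calls _ p(1) _ \<open>p < 2 ^ r\<close>, of ?n a] per
      unfolding C_def by blast
    \<comment> \<open>A block longer than \<open>C\<close> cannot start within \<open>C\<close> of
      the end of \<open>w\<close>.\<close>
    then have "s' \<le> a + C"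
      using big' K by auto
    moreover have "s < s'"
      using s(1) less_le_trans[of s "s + 2 ^ r" s'] by simp
    ultimately show ?thesis
      using s by (intro exI[of _ s] exI[of _ s']) auto
  next
    assume w: "w = rev xs"
    \<comment> \<open>Reversal moves the periodic part to the first \<open>?n - a\<close>
      positions.\<close>
    have per_rev: "w ! (i + p) = w ! i" if "0 \<le> i" "i + p < ?n - a" for i
    proof -
      have "?n - Suc i = ?n - Suc (i + p) + p" "a \<le> ?n - Suc (i + p)"
        "?n - Suc (i + p) + p < ?n"
        using that by auto
      then show ?thesis
        using per[of "?n - Suc (i + p)"] unfolding w by (subst (1 2) rev_nth) (use that in auto)
    qed
    obtain s s' where s: "s + 2 ^ r \<le> s'" "s' + 2 ^ r \<le> length w"
      "\<And>t. t < 2 ^ r \<Longrightarrow> w ! (s + t) = w ! (s' + t)" "s' \<le> 0 + C \<or> ?n - a \<le> s' + C"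
      using is_rec_calls_repeated_block[OF calls _ p(1) per_rev \<open>p < 2 ^ r\<close>] w
      unfolding C_def by (metis diff_le_self length_rev)
    have len: "length w = ?n"
      by (simp add: w)
    have "xs ! (?n - s' - 2 ^ r + u) = xs ! (?n - s - 2 ^ r + u)" if "u < 2 ^ r" for u
    proof -
      have "xs ! (?n - s' - 2 ^ r + u) = w ! (s' + (2 ^ r - 1 - u))"
        using that s len by (simp add: w rev_nth)
      also have "\<dots> = w ! (s + (2 ^ r - 1 - u))"
        by (rule s(3)[symmetric]) simp
      also have "\<dots> = xs ! (?n - s - 2 ^ r + u)"
        using that s len by (simp add: w rev_nth)
      finally show ?thesis .
    qed
    \<comment> \<open>The later block starts at \<open>s' >= 2 ^ r > C\<close>, beyond the error
      zone at the left end.\<close>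
    moreover have "?n - a \<le> s' + C"
      using s big' K by auto
    moreover have "s < s'"
      using s(1) less_le_trans[of s "s + 2 ^ r" s'] by simp
    ultimately show ?thesis
      using s len a by (intro exI[of _ "?n - s' - 2 ^ r"] exI[of _ "?n - s - 2 ^ r"]) auto
  qed
  then obtain t t' where t: "t < t'" "t' + 2 ^ r \<le> ?n" "t + 2 ^ r \<le> a + C"
    "\<forall>u<2 ^ r. xs ! (t + u) = xs ! (t' + u)" by blast
  have "\<exists>u<?K. xs ! (t + (j * ?K + u)) \<notin> D" if "j < R" for j
  proof -
    have "Suc j * ?K \<le> R * ?K"
      using that by (intro mult_right_mono) auto
    then have "t + j * ?K + 2 * ?K \<le> a"
      using big' t(3) by simp
    from choice[OF this] show ?thesis by (simp add: add.assoc)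
  qed
  then have "R \<le> card {u. u < R * ?K \<and> xs ! (t + u) \<notin> D}"
    by (rule card_ge_windows)
  also have "\<dots> \<le> card {u. u + 1 < 2 ^ r \<and> xs ! (t + u) \<notin> D}"
  proof (rule card_mono)
    have "R * ?K + 1 \<le> 2 ^ r"
      using big' K by linarith
    then show "{u. u < R * ?K \<and> xs ! (t + u) \<notin> D} \<subseteq> {u. u + 1 < 2 ^ r \<and> xs ! (t + u) \<notin> D}"
      by auto
  qed (auto intro: finite_subset[of _ "{..<2 ^ r}"])
  finally show ?thesis
    using t unfolding repeats_with_choices_def by blast
qed

section \<open>Repetitions in a Markov chain\<close>

lemma right_to_left_eq_rev: "right_to_left X n \<omega> = rev (left_to_right X n \<omega>)"
  by (intro nth_equalityI) (auto simp: right_to_left_def left_to_right_def rev_nth)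

lemma sum_lists_Suc:
  fixes g :: "'a::finite list \<Rightarrow> real"
  shows "(\<Sum>xs | length xs = Suc n. g xs) = (\<Sum>xs | length xs = n. \<Sum>y\<in>UNIV. g (xs @ [y]))"
proof -
  have "(\<Sum>xs | length xs = n. \<Sum>y\<in>UNIV. g (xs @ [y]))
      = (\<Sum>(xs, y)\<in>{xs. length xs = n} \<times> UNIV. g (xs @ [y]))"
    by (simp add: sum.cartesian_product)
  also have "\<dots> = (\<Sum>xs | length xs = Suc n. g xs)"
    by (rule sum.reindex_bij_witness[of _ "\<lambda>xs. (butlast xs, last xs)" "\<lambda>(xs, y). xs @ [y]"])
      (auto simp: length_Suc_conv_rev)
  finally show ?thesis by simp
qed

lemma finite_lists_length: "finite {xs :: 'a::finite list. length xs = n}"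
  using finite_lists_length_eq[of "UNIV :: 'a set" n] by simp

lemma repeats_with_choices_cong:
  assumes "t < t'" "\<And>k. k < t' + L \<Longrightarrow> x k = y k"
  shows "repeats_with_choices D L R x t t' \<longleftrightarrow> repeats_with_choices D L R y t t'"
proof -
  have "x (t + u) = y (t + u)" "x (t' + u) = y (t' + u)" if "u < L" for u
    using assms that by auto
  then have "(\<forall>u<L. x (t + u) = x (t' + u)) \<longleftrightarrow> (\<forall>u<L. y (t + u) = y (t' + u))"
    "{u. u + 1 < L \<and> x (t + u) \<notin> D} = {u. u + 1 < L \<and> y (t + u) \<notin> D}"
    by auto
  then show ?thesis
    unfolding repeats_with_choices_def by simp
qed

section \<open>Path probabilities of the chain\<close>

context finite_markov_chain
begin

definition path_prob :: "'a list \<Rightarrow> real" where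
  "path_prob xs = prob {\<omega> \<in> space P. left_to_right X (length xs) \<omega> = xs}"

lemma left_to_right_eq_iff:
  "left_to_right X (length xs) \<omega> = xs \<longleftrightarrow> (\<forall>k<length xs. X k \<omega> = xs ! k)"
  unfolding left_to_right_def list_eq_iff_nth_eq by simp

lemma measurable_left_to_right: "left_to_right X n \<in> measurable P (count_space UNIV)"
proof -
  have "left_to_right X n -` {xs} \<inter> space P \<in> sets P" for xs
  proof (cases "length xs = n")
    case True
    then have "left_to_right X n -` {xs} \<inter> space P = {\<omega> \<in> space P. \<forall>k<n. X k \<omega> = xs ! k}"
      using left_to_right_eq_iff[of xs] by auto
    also have "\<dots> \<in> sets P"
      using X_measurable by measurable
    finally show ?thesis .
  next
    case False
    then have "left_to_right X n -` {xs} \<inter> space P = {}"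
      by (auto simp: left_to_right_def)
    then show ?thesis by simp
  qed
  then show ?thesis
    by (subst measurable_count_space_eq2_countable) auto
qed

lemma sets_left_to_right: "{\<omega> \<in> space P. Q (left_to_right X n \<omega>)} \<in> sets P"
  using measurable_sets[OF measurable_left_to_right, of "Collect Q" n]
  by (simp add: vimage_def Int_def conj_commute)

lemma prob_left_to_right:
  "prob {\<omega> \<in> space P. Q (left_to_right X n \<omega>)} = (\<Sum>xs | length xs = n. if Q xs then path_prob xs else 0)"
proof -
  let ?I = "{xs. length xs = n \<and> Q xs}"
  have fin: "finite ?I"
    by (rule finite_subset[OF _ finite_lists_length[of n]]) auto
  have "{\<omega> \<in> space P. Q (left_to_right X n \<omega>)}
      = (\<Union>xs\<in>?I. {\<omega> \<in> space P. left_to_right X n \<omega> = xs})"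
    by (auto simp: left_to_right_def)
  also have "prob \<dots> = (\<Sum>xs\<in>?I. prob {\<omega> \<in> space P. left_to_right X n \<omega> = xs})"
    using fin sets_left_to_right[of "\<lambda>ys. ys = _"]
    by (intro finite_measure_finite_Union) (auto simp: disjoint_family_on_def)
  also have "\<dots> = (\<Sum>xs\<in>?I. path_prob xs)"
    by (intro sum.cong) (auto simp: path_prob_def)
  also have "\<dots> = (\<Sum>xs | length xs = n. if Q xs then path_prob xs else 0)"
    using finite_lists_length[of n] by (intro sum.mono_neutral_cong_left) auto
  finally show ?thesis .
qed

lemma path_prob_nonneg: "0 \<le> path_prob xs"
  by (simp add: path_prob_def)

text \<open>The Markov property in product form. \<open>X_step\<close> speaks only of pasts of
  positive probability; for a null past both sides vanish by monotonicity.\<close>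

lemma path_prob_snoc:
  assumes "xs \<noteq> []"
  shows "path_prob (xs @ [y]) = path_prob xs * M (last xs) y"
proof -
  define n where "n = length xs - 1"
  have n: "length xs = n + 1"
    using assms by (cases xs) (auto simp: n_def)
  define x where "x k = (xs @ [y]) ! k" for k
  have x: "x k = xs ! k" if "k < n + 1" for k
    using that n by (simp add: x_def nth_append)
  have past: "{\<omega> \<in> space P. \<forall>k<n+1. X k \<omega> = x k} = {\<omega> \<in> space P. left_to_right X (length xs) \<omega> = xs}"
    unfolding left_to_right_eq_iff using x n by auto
  have step: "{\<omega> \<in> space P. X (n + 1) \<omega> = x (n + 1) \<and> (\<forall>k<n+1. X k \<omega> = x k)}
      = {\<omega> \<in> space P. left_to_right X (length (xs @ [y])) \<omega> = xs @ [y]}"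
    unfolding left_to_right_eq_iff x_def using n by (auto simp: less_Suc_eq)
  have xn: "x n = last xs" "x (n + 1) = y"
    using n assms by (auto simp: x_def nth_append last_conv_nth)
  show ?thesis
  proof (cases "path_prob xs = 0")
    case True
    have "path_prob (xs @ [y]) \<le> path_prob xs"
      unfolding path_prob_def step[symmetric] past[symmetric]
    proof (rule finite_measure_mono)
      show "{\<omega> \<in> space P. \<forall>k<n+1. X k \<omega> = x k} \<in> sets P"
        unfolding past by (rule sets_left_to_right)
    qed blast
    with True path_prob_nonneg[of "xs @ [y]"] show ?thesis by simp
  next
    case False
    then have "path_prob xs > 0"
      using path_prob_nonneg[of xs] by simp
    then have "\<P>(\<omega> in P. X (n + 1) \<omega> = x (n + 1) \<bar> \<forall>k<n+1. X k \<omega> = x k) = M (x n) (x (n + 1))"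
      by (intro X_step) (simp only: past path_prob_def)
    then have "path_prob (xs @ [y]) / path_prob xs = M (last xs) y"
      unfolding cond_prob_def step past xn(1) path_prob_def unfolding xn(2) .
    with False show ?thesis by (simp add: field_simps)
  qed
qed

lemma sum_path_prob: "(\<Sum>xs | length xs = n. path_prob xs) = 1"
  using prob_left_to_right[of "\<lambda>_. True" n] by (simp add: prob_space)

lemma M_le_1: "M x y \<le> 1"
  using member_le_sum[of y UNIV "M x"] M_nonneg M_sum[of x] by simp

section \<open>Forced states and the cost of a repetition\<close>

definition forced :: "'a set" where
  "forced = {x. \<exists>y. M x y = 1}"

text \<open>Almost surely a forced state is thus followed by its sure successor, which gives the
  determinism that \<open>is_rec_calls_repeats\<close> assumes.\<close>

lemma AE_transition_nonzero: "AE \<omega> in P. \<forall>k. M (X k \<omega>) (X (Suc k) \<omega>) \<noteq> 0"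
proof -
  have "AE \<omega> in P. M (X k \<omega>) (X (Suc k) \<omega>) \<noteq> 0" for k
  proof -
    let ?Q = "\<lambda>xs. M (xs ! k) (xs ! Suc k) = 0"
    have "path_prob xs = 0" if xs: "length xs = Suc (Suc k)" "?Q xs" for xs
    proof -
      obtain ys y where ys: "xs = ys @ [y]" "length ys = Suc k"
        using xs(1) unfolding length_Suc_conv_rev by blast
      then have "ys \<noteq> []" by auto
      moreover from this have "M (last ys) y = 0"
        using xs(2) ys by (simp add: last_conv_nth nth_append)
      ultimately show ?thesis
        by (simp add: ys(1) path_prob_snoc)
    qed
    then have "prob {\<omega> \<in> space P. ?Q (left_to_right X (Suc (Suc k)) \<omega>)} = 0"
      unfolding prob_left_to_right[of ?Q] by (intro sum.neutral) auto
    then have "AE \<omega> in P. \<not> ?Q (left_to_right X (Suc (Suc k)) \<omega>)"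
      using sets_left_to_right[of ?Q "Suc (Suc k)"]
      by (subst AE_iff_measurable[OF _ refl]) (auto simp: emeasure_eq_measure)
    then show ?thesis
      by eventually_elim (simp add: left_to_right_def del: upt_Suc)
  qed
  then show ?thesis by (simp add: AE_all_countable)
qed

lemma forced_unique:
  assumes "M x y = 1" "M x z \<noteq> 0"
  shows "z = y"
proof (rule ccontr)
  assume "z \<noteq> y"
  then have "M x y + M x z = (\<Sum>u\<in>{y, z}. M x u)" by simp
  also have "\<dots> \<le> (\<Sum>u\<in>UNIV. M x u)"
    by (intro sum_mono2) (auto simp: M_nonneg)
  finally show False
    using assms M_sum[of x] M_nonneg[of x z] by simp
qed

text \<open>The process \<open>\<rho>\<close> to the power minus the number of unforced letters matched so far,
  killed at the first mismatch, is a supermartingale.\<close>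

lemma sum_matching_weights_le_1:
  assumes "t < t'" "0 < \<rho>" "\<rho> \<le> 1" "\<And>x y. x \<notin> forced \<Longrightarrow> M x y \<le> \<rho>"
  shows "(\<Sum>xs | length xs = Suc (t' + u). path_prob xs *
           (if \<forall>v\<le>u. xs ! (t + v) = xs ! (t' + v)
            then (1 / \<rho>) ^ card {v. v < u \<and> xs ! (t + v) \<notin> forced} else 0)) \<le> 1"
    (is "(\<Sum>xs | _. path_prob xs * ?W u xs) \<le> 1")
proof (induction u)
  case 0
  have "(\<Sum>xs | length xs = Suc (t' + 0). path_prob xs * ?W 0 xs)
      \<le> (\<Sum>xs | length xs = Suc (t' + 0). path_prob xs)"
    by (intro sum_mono) (auto simp: path_prob_nonneg)
  then show ?case by (simp only: sum_path_prob)
next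
  case (Suc u)
  let ?n = "Suc (t' + u)"
  have step: "(\<Sum>y\<in>UNIV. M (last xs) y * ?W (Suc u) (xs @ [y])) \<le> ?W u xs"
    if xs: "length xs = ?n" for xs
  proof -
    \<comment> \<open>Because \<open>t < t'\<close>, the letter that \<open>y\<close> has to match
      already belongs to \<open>xs\<close>, so at most one \<open>y\<close> continues the
      repetition.\<close>
    have nth: "(xs @ [y]) ! (t + v) = xs ! (t + v)" if "v \<le> Suc u" for v y
      using that xs \<open>t < t'\<close> by (simp add: nth_append)
    have nth': "(xs @ [y]) ! (t' + v) = xs ! (t' + v)" if "v \<le> u" for v y
      using that xs by (simp add: nth_append)
    have new: "(xs @ [y]) ! (t' + Suc u) = y" for y
      using xs by (simp add: nth_append)
    have last: "last xs = xs ! (t' + u)"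
      using xs by (cases "xs = []") (auto simp: last_conv_nth)
    let ?b = "if xs ! (t + u) \<in> forced then 1 else 1 / \<rho>"
    have card: "(1 / \<rho>) ^ card {v. v < Suc u \<and> (xs @ [y]) ! (t + v) \<notin> forced}
        = (1 / \<rho>) ^ card {v. v < u \<and> xs ! (t + v) \<notin> forced} * ?b" for y
    proof -
      have "{v. v < Suc u \<and> (xs @ [y]) ! (t + v) \<notin> forced}
          = {v. v < u \<and> xs ! (t + v) \<notin> forced} \<union> (if xs ! (t + u) \<in> forced then {} else {u})"
        using nth by (auto simp: less_Suc_eq)
      then show ?thesis by simp
    qed
    have W: "?W (Suc u) (xs @ [y]) = (if xs ! (t + Suc u) = y then ?W u xs * ?b else 0)" for y
    proof -
      have match: "(\<forall>v\<le>Suc u. (xs @ [y]) ! (t + v) = (xs @ [y]) ! (t' + v)) \<longleftrightarrow>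
          (\<forall>v\<le>u. xs ! (t + v) = xs ! (t' + v)) \<and> xs ! (t + Suc u) = y"
        using nth nth' new by (auto simp: le_Suc_eq)
      have if_conj: "(if G' then d * b else 0) = (if e then (if G then d else 0) * b else 0)"
        if "G' \<longleftrightarrow> G \<and> e" for G' G e and d b :: real
        using that by simp
      show ?thesis
        unfolding card by (rule if_conj[OF match])
    qed
    have "(\<Sum>y\<in>UNIV. M (last xs) y * ?W (Suc u) (xs @ [y]))
        = (\<Sum>y\<in>UNIV. if xs ! (t + Suc u) = y then M (last xs) y * (?W u xs * ?b) else 0)"
      unfolding W by (intro sum.cong) auto
    also have "\<dots> = M (last xs) (xs ! (t + Suc u)) * (?W u xs * ?b)"
      by simp
    also have "\<dots> \<le> ?W u xs"
    proof (cases "\<forall>v\<le>u. xs ! (t + v) = xs ! (t' + v)")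
      case True
      \<comment> \<open>The match so far identifies the current state with the one that
        \<open>?b\<close> inspects; leaving it, if unforced, costs a factor of at most
        \<open>\<rho>\<close>, which cancels \<open>?b\<close>.\<close>
      then have "last xs = xs ! (t + u)"
        using last by simp
      then have "M (last xs) (xs ! (t + Suc u)) * ?b \<le> 1"
        using assms(2) assms(4)[of "last xs"] M_le_1[of "last xs"] by (auto simp: field_simps)
      moreover have "0 \<le> ?W u xs"
        using assms(2) by simp
      ultimately have "(M (last xs) (xs ! (t + Suc u)) * ?b) * ?W u xs \<le> 1 * ?W u xs"
        by (rule mult_right_mono)
      then show ?thesis by (simp only: mult_ac mult_1)
    qed auto
    finally show ?thesis .
  qed
  have "(\<Sum>xs | length xs = Suc (t' + Suc u). path_prob xs * ?W (Suc u) xs)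
      = (\<Sum>xs | length xs = ?n. \<Sum>y\<in>UNIV. path_prob (xs @ [y]) * ?W (Suc u) (xs @ [y]))"
    using sum_lists_Suc[of "\<lambda>xs. path_prob xs * ?W (Suc u) xs" ?n] by simp
  also have "\<dots> = (\<Sum>xs | length xs = ?n. path_prob xs * (\<Sum>y\<in>UNIV. M (last xs) y * ?W (Suc u) (xs @ [y])))"
  proof (intro sum.cong refl)
    fix xs :: "'a list" assume "xs \<in> {xs. length xs = ?n}"
    then have "xs \<noteq> []" by auto
    then show "(\<Sum>y\<in>UNIV. path_prob (xs @ [y]) * ?W (Suc u) (xs @ [y]))
        = path_prob xs * (\<Sum>y\<in>UNIV. M (last xs) y * ?W (Suc u) (xs @ [y]))"
      by (simp only: path_prob_snoc[OF \<open>xs \<noteq> []\<close>] sum_distrib_left mult.assoc)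
  qed
  also have "\<dots> \<le> (\<Sum>xs | length xs = ?n. path_prob xs * ?W u xs)"
    using step by (intro sum_mono mult_left_mono path_prob_nonneg) auto
  finally show ?case using Suc.IH by simp
qed

text \<open>Markov's inequality: on the event, a weight of expectation at most 1 is at least
  \<open>(1 / \<rho>) ^ R\<close>.\<close>

lemma prob_repeats_with_choices_le:
  assumes "t < t'" "0 < L" "0 < \<rho>" "\<rho> \<le> 1" "\<And>x y. x \<notin> forced \<Longrightarrow> M x y \<le> \<rho>"
  shows "{\<omega> \<in> space P. repeats_with_choices forced L R (\<lambda>k. X k \<omega>) t t'} \<in> sets P" (is "?E \<in> _")
    and "prob {\<omega> \<in> space P. repeats_with_choices forced L R (\<lambda>k. X k \<omega>) t t'} \<le> \<rho> ^ R"
proof -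
  obtain u where u: "L = Suc u"
    using \<open>0 < L\<close> by (cases L) auto
  let ?n = "Suc (t' + u)"
  let ?Q = "\<lambda>xs. repeats_with_choices forced L R ((!) xs) t t'"
  let ?W = "\<lambda>xs. if \<forall>v\<le>u. xs ! (t + v) = xs ! (t' + v)
            then (1 / \<rho>) ^ card {v. v < u \<and> xs ! (t + v) \<notin> forced} else 0"
  have "?Q (left_to_right X ?n \<omega>) \<longleftrightarrow> repeats_with_choices forced L R (\<lambda>k. X k \<omega>) t t'" for \<omega>
    using u \<open>t < t'\<close> by (intro repeats_with_choices_cong) (auto simp: left_to_right_def simp del: upt_Suc)
  then have E: "?E = {\<omega> \<in> space P. ?Q (left_to_right X ?n \<omega>)}"
    by simp
  then show "?E \<in> sets P"
    using sets_left_to_right[of ?Q] by simp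
  have "prob ?E = (\<Sum>xs | length xs = ?n. if ?Q xs then path_prob xs else 0)"
    unfolding E by (rule prob_left_to_right)
  also have "\<dots> \<le> (\<Sum>xs | length xs = ?n. \<rho> ^ R * (path_prob xs * ?W xs))"
  proof (intro sum_mono)
    fix xs
    show "(if ?Q xs then path_prob xs else 0) \<le> \<rho> ^ R * (path_prob xs * ?W xs)"
    proof (cases "?Q xs")
      case True
      let ?B = "card {v. v < u \<and> xs ! (t + v) \<notin> forced}"
      have "\<forall>v\<le>u. xs ! (t + v) = xs ! (t' + v)" "R \<le> ?B"
        using True unfolding repeats_with_choices_def u by auto
      moreover from this have "1 \<le> \<rho> ^ R * (1 / \<rho>) ^ ?B"
        using assms(3,4) power_decreasing[of R ?B \<rho>] by (simp add: field_simps)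
      then have "path_prob xs * 1 \<le> path_prob xs * (\<rho> ^ R * (1 / \<rho>) ^ ?B)"
        by (intro mult_left_mono path_prob_nonneg)
      ultimately show ?thesis using True by (simp add: mult_ac)
    next
      case False
      then show ?thesis using assms(3) path_prob_nonneg[of xs] by simp
    qed
  qed
  also have "\<dots> = \<rho> ^ R * (\<Sum>xs | length xs = ?n. path_prob xs * ?W xs)"
    by (rule sum_distrib_left[symmetric])
  also have "\<dots> \<le> \<rho> ^ R * 1"
    using assms(3) by (intro mult_left_mono sum_matching_weights_le_1 assms) auto
  finally show "prob ?E \<le> \<rho> ^ R" by simp
qed

lemma obtain_choice_bound:
  obtains \<rho> where "0 < \<rho>" "\<rho> < 1" "\<And>x y. x \<notin> forced \<Longrightarrow> M x y \<le> \<rho>"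
proof -
  \<comment> \<open>The entry \<open>1 / 2\<close> keeps the maximum defined and positive even if
    all states are forced.\<close>
  let ?S = "insert (1 / 2) ((\<lambda>(x, y). M x y) ` ((- forced) \<times> UNIV))"
  have fin: "finite ?S" by simp
  have "s < 1" if "s \<in> ?S" for s
    using that M_le_1 by (fastforce simp: forced_def less_le)
  then have "Max ?S < 1"
    using fin by (subst Max_less_iff) auto
  moreover have "1 / 2 \<le> Max ?S"
    using fin by (intro Max_ge) auto
  moreover have "M x y \<le> Max ?S" if "x \<notin> forced" for x y
    using fin that by (intro Max_ge) auto
  ultimately show ?thesis
    by (intro that[of "Max ?S"]) auto
qed

end

text \<open>Union bound over the pairs of start positions of the two equal blocks. It is stated
  outside the locale, whose alphabet carries no order.\<close>

lemma prob_is_rec_calls_le: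
  fixes P :: "'w measure" and \<mu> :: "'a::{finite,linorder} \<Rightarrow> real"
  assumes "finite_markov_chain P \<mu> M X"
    and w: "w = left_to_right X \<or> w = right_to_left X"
    and \<rho>: "0 < \<rho>" "\<rho> \<le> 1" "\<And>x y. x \<notin> finite_markov_chain.forced M \<Longrightarrow> M x y \<le> \<rho>"
    and r: "0 < r" "CARD('a) * (R + 2 + 2 * r) \<le> 2 ^ r"
  shows "\<P>(\<omega> in P. r \<le> is_rec_calls (w n \<omega>)) \<le> (real n)\<^sup>2 * \<rho> ^ R"
proof -
  interpret finite_markov_chain P \<mu> M X by fact
  let ?I = "{(t, t'). t < t' \<and> t' < n}"
  let ?E = "\<lambda>(t, t'). {\<omega> \<in> space P. repeats_with_choices forced (2 ^ r) R (\<lambda>k. X k \<omega>) t t'}"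
  have sub: "?I \<subseteq> {..<n} \<times> {..<n}" by auto
  have fin: "finite ?I" by (rule finite_subset[OF sub]) simp
  have E: "?E i \<in> sets P" "prob (?E i) \<le> \<rho> ^ R" if "i \<in> ?I" for i
    using that prob_repeats_with_choices_le[OF _ _ \<rho>] by auto
  have "AE \<omega> in P. r \<le> is_rec_calls (w n \<omega>) \<longrightarrow> \<omega> \<in> (\<Union>i\<in>?I. ?E i)"
    using AE_transition_nonzero AE_space
  proof eventually_elim
    case (elim \<omega>)
    let ?xs = "left_to_right X n \<omega>"
    show ?case
    proof
      assume calls: "r \<le> is_rec_calls (w n \<omega>)"
      have nth: "?xs ! k = X k \<omega>" if "k < n" for k
        using that by (simp add: left_to_right_def)
      have len: "length ?xs = n"
        by (simp add: left_to_right_def)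
      \<comment> \<open>The description is evaluated only at forced states, where the sure successor
        is unique.\<close>
      have det: "?xs ! Suc i = (THE y. M (?xs ! i) y = 1)"
        if "Suc i < length ?xs" "?xs ! i \<in> forced" for i
      proof -
        have "M (?xs ! i) (?xs ! Suc i) \<noteq> 0"
          using elim(1) that nth len by simp
        then show ?thesis
          using that(2) forced_unique M_sum unfolding forced_def
          by (intro the_equality[symmetric]) force+
      qed
      have "w n \<omega> = ?xs \<or> w n \<omega> = rev ?xs"
        using w by (auto simp: right_to_left_eq_rev)
      from is_rec_calls_repeats[where xs = ?xs and D = forced, OF det this calls r]
      obtain t t' where t: "t < t'" "t' + 2 ^ r \<le> n"
        "repeats_with_choices forced (2 ^ r) R ((!) ?xs) t t'"
        unfolding len by blast
      then have "repeats_with_choices forced (2 ^ r) R (\<lambda>k. X k \<omega>) t t'"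
        using nth by (subst (asm) repeats_with_choices_cong[of t t' "2 ^ r" _ "\<lambda>k. X k \<omega>"]) auto
      moreover have "t' < n"
        using t(2) less_le_trans[of t' "t' + 2 ^ r" n] by simp
      ultimately show "\<omega> \<in> (\<Union>i\<in>?I. ?E i)"
        using t(1) elim(2) by auto
    qed
  qed
  then have "\<P>(\<omega> in P. r \<le> is_rec_calls (w n \<omega>)) \<le> prob (\<Union>i\<in>?I. ?E i)"
    using fin E(1) by (intro finite_measure_mono_AE) auto
  also have "\<dots> \<le> (\<Sum>i\<in>?I. prob (?E i))"
    using fin E(1) by (intro finite_measure_subadditive_finite) auto
  also have "\<dots> \<le> real (card ?I) * \<rho> ^ R"
    using E(2) by (rule sum_bounded_above)
  also have "real (card ?I) \<le> real (card ({..<n} \<times> {..<n}))"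
    using sub by (intro of_nat_mono card_mono) auto
  then have "real (card ?I) * \<rho> ^ R \<le> (real n)\<^sup>2 * \<rho> ^ R"
    using \<rho>(1) by (intro mult_right_mono) (auto simp: power2_eq_square)
  finally show ?thesis .
qed

theorem theorem20:
  fixes P :: "'w measure"
    and \<mu> :: "'a::{finite,linorder} \<Rightarrow> real"
    and M :: "'a \<Rightarrow> 'a \<Rightarrow> real"
    and X :: "nat \<Rightarrow> 'w \<Rightarrow> 'a"
    and w :: "nat \<Rightarrow> 'w \<Rightarrow> 'a list"
  assumes "finite_markov_chain P \<mu> M X"
    and "w = left_to_right X \<or> w = right_to_left X"
  shows "\<forall>l::nat. \<exists>N::nat. \<forall>n\<ge>N.
           \<P>(\<omega> in P. real (is_rec_calls (w n \<omega>)) > 2 * log 2 (log 2 (real n)) + real l)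
             \<le> real n powr (- (2 ^ l))"
proof
  fix l :: nat
  interpret finite_markov_chain P \<mu> M X by fact
  obtain \<rho> where \<rho>: "0 < \<rho>" "\<rho> < 1" "\<And>x y. x \<notin> forced \<Longrightarrow> M x y \<le> \<rho>"
    using obtain_choice_bound by blast
  define c where "c = - ln \<rho>"
  define A where "A = (2 :: real) ^ l"
  define K where "K = real CARD('a)"
  have "0 < c" "0 < A" "0 < K"
    using \<rho> by (auto simp: c_def A_def K_def card_gt_0_iff)
  \<comment> \<open>The left side grows like \<open>ln n\<close>, the right side like its square.
    The 5 collects the summand 2 of the block-length condition, 1 for the ceiling in
    \<open>R\<close>, and 2 for rounding up \<open>r\<close>, which counts twice.\<close>
  have "eventually (\<lambda>n. K * ((A + 2) * ln (real n) / c + 5 + 2 * (2 * log 2 (log 2 (real n)) + real l))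
          \<le> A * (log 2 (real n))\<^sup>2) sequentially"
    using \<open>0 < c\<close> \<open>0 < A\<close> \<open>0 < K\<close> by real_asymp
  moreover have "eventually (\<lambda>n. 2 * log 2 (log 2 (real n)) \<ge> 0) sequentially"
    by real_asymp
  moreover have "eventually (\<lambda>n. log 2 (real n) > 0) sequentially"
    by real_asymp
  ultimately have "eventually (\<lambda>n.
      \<P>(\<omega> in P. real (is_rec_calls (w n \<omega>)) > 2 * log 2 (log 2 (real n)) + real l)
        \<le> real n powr (- (2 ^ l))) sequentially"
    using eventually_gt_at_top[of 0]
  proof eventually_elim
    case (elim n)
    define T where "T = 2 * log 2 (log 2 (real n)) + real l"
    \<comment> \<open>\<open>r\<close> is the least natural number above \<open>T\<close>, so more
      than \<open>T\<close> calls means at least \<open>r\<close>. \<open>R\<close> is chosen to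
      give \<open>\<rho> ^ R\<close> at most \<open>n powr (- (A + 2))\<close>; the extra 2 absorbs
      the factor \<open>n^2\<close> from the pairs.\<close>
    define r where "r = nat (\<lfloor>T\<rfloor> + 1)"
    define R where "R = nat \<lceil>(A + 2) * ln (real n) / c\<rceil>"
    have "0 \<le> T"
      using elim(2) by (simp add: T_def)
    then have r: "T < real r" "real r \<le> T + 1" "0 < r"
      unfolding r_def by linarith+
    have ln: "0 \<le> ln (real n)"
      using elim(4) by simp
    then have "0 \<le> (A + 2) * ln (real n) / c"
      using \<open>0 < A\<close> \<open>0 < c\<close> by simp
    then have R: "(A + 2) * ln (real n) / c \<le> real R" "real R \<le> (A + 2) * ln (real n) / c + 1"
      unfolding R_def by linarith+
    have "A * (log 2 (real n))\<^sup>2 = 2 powr T"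
      using elim(3) by (simp add: T_def A_def powr_add powr_realpow powr_powr[symmetric] mult.commute[of 2])
    also have "\<dots> \<le> 2 ^ r"
      using r(1) by (simp add: powr_realpow[symmetric])
    finally have pow: "A * (log 2 (real n))\<^sup>2 \<le> 2 ^ r" .
    have "K * (real R + 2 + 2 * real r)
        \<le> K * ((A + 2) * ln (real n) / c + 5 + 2 * (2 * log 2 (log 2 (real n)) + real l))"
      using R(2) r(2) \<open>0 < K\<close> by (intro mult_left_mono) (auto simp: T_def)
    also have "\<dots> \<le> 2 ^ r"
      using elim(1) pow by linarith
    finally have "real (CARD('a) * (R + 2 + 2 * r)) \<le> real (2 ^ r)"
      by (simp add: K_def algebra_simps)
    then have big: "CARD('a) * (R + 2 + 2 * r) \<le> 2 ^ r"
      by (simp only: of_nat_le_iff)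
    have "real k > T \<longleftrightarrow> r \<le> k" for k
      unfolding r_def using \<open>0 \<le> T\<close> by linarith
    then have "\<P>(\<omega> in P. real (is_rec_calls (w n \<omega>)) > T) = \<P>(\<omega> in P. r \<le> is_rec_calls (w n \<omega>))"
      by simp
    also have "\<dots> \<le> (real n)\<^sup>2 * \<rho> ^ R"
      using assms \<rho> r(3) big by (intro prob_is_rec_calls_le) auto
    also have "\<dots> \<le> (real n)\<^sup>2 * real n powr (- (A + 2))"
    proof (intro mult_left_mono)
      have "\<rho> ^ R = exp (- (c * real R))"
        using \<rho>(1) by (simp add: c_def exp_of_nat_mult mult.commute[of _ "real R"])
      also have "\<dots> \<le> exp (- ((A + 2) * ln (real n)))"
        using R(1) \<open>0 < c\<close> by (simp add: field_simps)
      also have "\<dots> = real n powr (- (A + 2))"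
        using elim(4) by (simp add: powr_def algebra_simps)
      finally show "\<rho> ^ R \<le> real n powr (- (A + 2))" .
    qed simp
    also have "\<dots> = real n powr (2 + - (A + 2))"
      using elim(4) powr_realpow[of "real n" 2] by (simp only: powr_add) simp
    finally show ?case
      by (simp add: T_def A_def)
  qed
  then show "\<exists>N. \<forall>n\<ge>N. \<P>(\<omega> in P. real (is_rec_calls (w n \<omega>)) > 2 * log 2 (log 2 (real n)) + real l)
      \<le> real n powr (- (2 ^ l))"
    by (simp add: eventually_sequentially)
qed

end
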